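(* Let $K\subseteq\mathbb{R}^m$ be a closed convex set and let $F:K\to\mathbb{R}^m$ be Lipschitz continuous with a constant $L>0$. Assume that $\mathrm{Sol}(K,F)$ is nonempty and that there is $\eta>0$ such that for every $x\in K$ there is $v_x^*\in S(x)$ with $$\langle F(x)-F(v_x^* ),x-v_x^*\rangle\ge\eta\,\mathrm{dist}^2(x,\mathrm{Sol}(K,F)),$$ where $S(x)$ is the set of points of $\mathrm{cl}(\mathrm{Sol}(K,F))$ that attain the distance from $x$ to $\mathrm{cl}(\mathrm{Sol}(K,F))$. Let $0<\alpha<\min\{\frac{\eta}{L^2},\frac{1}{2L}\}$, $\lambda\in(0,\frac{2\eta}{L^2})$ and $0<\zeta<\frac12$. For $x,y\in K$ let $$S_\lambda(x,y)=\|x-\Pi_K[x-\lambda F(x)]\|^2+\|x-y\|^2,$$ $$\rho_{\lambda,\zeta}(x,y)=\begin{cases}S_\lambda(x,y)^{\frac12}+S_\lambda(x,y)^{\zeta-\frac12}&\text{if }S_\lambda(x,y)>0,\\ 0&\text{if }S_\lambda(x,y)=0.\end{cases}$$ Then the set $\{(x^*,x^* )\mid x^*\in\mathrm{Sol}(K,F)\}$ is fixed-time stable for the system $$\dot y=\rho_{\lambda,\zeta}(x,y)\left(\Pi_K[x-\alpha F(x)]-y\right),\qquad \dot x=\rho_{\lambda,\zeta}(x,y)\left(\Pi_K[x-\alpha F(y)]-x\right),$$ initialized at any $x(0),y(0)\in K$, with the settling-time bound $$\sup_{x(0),y(0)\in K}T(x(0),y(0))\le\frac{1}{\sqrt2\,d(1-c)}+\frac{2^{\frac12-\zeta}(1+c)}{d(1-c)^{2\zeta}(1-2\zeta)},$$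 where $d=\min\{\alpha(\eta-\alpha L^2),\frac12-\alpha L\}$ and $c=\sqrt{1-2\lambda\eta+\lambda^2L^2}$.
   Context: $\mathrm{Sol}(K,F)=\{x^*\in K\mid \langle F(x^* ),x-x^*\rangle\ge 0\ \text{for all }x\in K\}$. $\Pi_K$ is the Euclidean projection onto the closed convex set $K$; $\|\cdot\|$ is the Euclidean norm; $\mathrm{dist}(x,M)=\inf_{y\in M}\|x-y\|$; $M_\delta=\{x\mid\mathrm{dist}(x,M)<\delta\}$; $\mathrm{cl}$ denotes closure. For a system $\dot z=f(z)$ with domain $\mathrm{dom}(f)$ (here $\mathrm{dom}(f)=K\times K$): a set $M$ is positively invariant if $z(0)\in M$ implies $z(t)\in M$ for all $t\ge0$. $M$ is stable if for each $\varepsilon>0$ there is $\delta>0$ such that $z(t)\in M_\varepsilon$ for all $t\ge0$ and all $z(0)\in M_\delta\cap\mathrm{dom}(f)$. A closed positively invariant set $M$ is finite-time stable if it is stable and there is $\delta>0$ such that for every $z(0)\in (M_\delta\cap\mathrm{dom}(f))\setminus M$ there is a finite time $T(z(0))>0$ (the settling time) with $\lim_{t\to T(z(0))}\mathrm{dist}(z(t),M)=0$; it is globally finite-time stable if this holds for all initial points in $\mathrm{dom}(f)$ (the settling time being $0$ for $z(0)\in M$). A closed globally finite-time stable set $M$ is fixed-time stable if $\sup_{z(0)\in\mathrm{dom}(f)}T(z(0))<\infty$. Standing assumption: the vector field is continuous and the system has a unique solution on $[0,+\infty)$ for every initial point in $\mathrm{dom}(f)$.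
   Formalization: The settling-time bound is claimed only when 1−2λη+λ²L² ≥ 0, so that c is real; this can fail only if K = Sol(K,F) (e.g. K={0}, F=0, L=1, η=2, λ=1), where c is undefined. Fixed-time stability is proved without this condition. *)

theory Defs
  imports "HOL-Analysis.Analysis"
begin

definition VI_sol :: "'a::real_inner set \<Rightarrow> ('a \<Rightarrow> 'a) \<Rightarrow> 'a set" where
  "VI_sol K F = {u \<in> K. \<forall>x\<in>K. F u \<bullet> (x - u) \<ge> 0}"

definition nearest_points :: "'a::metric_space set \<Rightarrow> 'a \<Rightarrow> 'a set" where
  "nearest_points A x = {v \<in> A. dist x v = infdist x A}"

definition nbhd :: "'a::metric_space set \<Rightarrow> real \<Rightarrow> 'a set" where
  "nbhd M \<delta> = {x. infdist x M < \<delta>}"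

text \<open>Solutions of \<open>z' = f z\<close> on \<open>[0,\<infinity>)\<close> that stay in the domain \<open>D\<close> of \<open>f\<close>; the values of
  \<open>z\<close> at negative times are irrelevant, and the derivative at \<open>0\<close> is one-sided.\<close>

definition solution :: "('a::real_normed_vector \<Rightarrow> 'a) \<Rightarrow> 'a set \<Rightarrow> (real \<Rightarrow> 'a) \<Rightarrow> bool" where
  "solution f D z \<longleftrightarrow>
     (\<forall>t\<ge>0. z t \<in> D \<and> (z has_vector_derivative f (z t)) (at t within {0..}))"

definition well_posed :: "('a::real_normed_vector \<Rightarrow> 'a) \<Rightarrow> 'a set \<Rightarrow> bool" where
  "well_posed f D \<longleftrightarrow> continuous_on D f \<and>
     (\<forall>z0\<in>D. (\<exists>z. solution f D z \<and> z 0 = z0) \<and>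
        (\<forall>z w. solution f D z \<and> z 0 = z0 \<and> solution f D w \<and> w 0 = z0 \<longrightarrow> (\<forall>t\<ge>0. z t = w t)))"

definition positively_invariant ::
    "('a::real_normed_vector \<Rightarrow> 'a) \<Rightarrow> 'a set \<Rightarrow> 'a set \<Rightarrow> bool" where
  "positively_invariant f D M \<longleftrightarrow>
     (\<forall>z. solution f D z \<and> z 0 \<in> M \<longrightarrow> (\<forall>t\<ge>0. z t \<in> M))"

definition stable_set ::
    "('a::real_normed_vector \<Rightarrow> 'a) \<Rightarrow> 'a set \<Rightarrow> 'a set \<Rightarrow> bool" where
  "stable_set f D M \<longleftrightarrow>
     (\<forall>\<epsilon>>0. \<exists>\<delta>>0. \<forall>z. solution f D z \<and> z 0 \<in> nbhd M \<delta> \<inter> D \<longrightarrow> (\<forall>t\<ge>0. z t \<in> nbhd M \<epsilon>))"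

definition settles_at :: "'a::real_normed_vector set \<Rightarrow> (real \<Rightarrow> 'a) \<Rightarrow> real \<Rightarrow> bool" where
  "settles_at M z T \<longleftrightarrow> T > 0 \<and> ((\<lambda>t. infdist (z t) M) \<longlongrightarrow> 0) (at T)"

definition finite_time_stable ::
    "('a::real_normed_vector \<Rightarrow> 'a) \<Rightarrow> 'a set \<Rightarrow> 'a set \<Rightarrow> bool" where
  "finite_time_stable f D M \<longleftrightarrow>
     closed M \<and> positively_invariant f D M \<and> stable_set f D M \<and>
     (\<exists>\<delta>>0. \<forall>z. solution f D z \<and> z 0 \<in> (nbhd M \<delta> \<inter> D) - M \<longrightarrow> (\<exists>T. settles_at M z T))"

definition globally_finite_time_stable ::
    "('a::real_normed_vector \<Rightarrow> 'a) \<Rightarrow> 'a set \<Rightarrow> 'a set \<Rightarrow> bool" where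
  "globally_finite_time_stable f D M \<longleftrightarrow>
     finite_time_stable f D M \<and>
     (\<forall>z. solution f D z \<and> z 0 \<in> D - M \<longrightarrow> (\<exists>T. settles_at M z T))"

text \<open>Once a trajectory has entered a positively invariant set, every later time also satisfies
  \<^const>\<open>settles_at\<close>; the settling time is the least such time. For a well-posed system there is
  exactly one trajectory from \<open>z0\<close> (up to its values at negative times), so the existential
  quantifier over \<open>z\<close> is harmless. The infimum is meaningful only where some settling time exists.\<close>

definition settling_time ::
    "('a::real_normed_vector \<Rightarrow> 'a) \<Rightarrow> 'a set \<Rightarrow> 'a set \<Rightarrow> 'a \<Rightarrow> real" where
  "settling_time f D M z0 =
     (if z0 \<in> M then 0
      else Inf {T. \<exists>z. solution f D z \<and> z 0 = z0 \<and> settles_at M z T})"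

definition fixed_time_stable ::
    "('a::real_normed_vector \<Rightarrow> 'a) \<Rightarrow> 'a set \<Rightarrow> 'a set \<Rightarrow> bool" where
  "fixed_time_stable f D M \<longleftrightarrow>
     globally_finite_time_stable f D M \<and> bdd_above (settling_time f D M ` D)"

definition S_res :: "'a::euclidean_space set \<Rightarrow> ('a \<Rightarrow> 'a) \<Rightarrow> real \<Rightarrow> 'a \<Rightarrow> 'a \<Rightarrow> real" where
  "S_res K F lam x y =
     (norm (x - closest_point K (x - lam *\<^sub>R F x)))\<^sup>2 + (norm (x - y))\<^sup>2"

definition rho ::
    "'a::euclidean_space set \<Rightarrow> ('a \<Rightarrow> 'a) \<Rightarrow> real \<Rightarrow> real \<Rightarrow> 'a \<Rightarrow> 'a \<Rightarrow> real" where
  "rho K F lam \<zeta> x y =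
     (if S_res K F lam x y > 0
      then S_res K F lam x y powr (1/2) + S_res K F lam x y powr (\<zeta> - 1/2)
      else 0)"

text \<open>The state is the pair \<open>(x, y)\<close>, in this order.\<close>

definition vi_field ::
    "'a::euclidean_space set \<Rightarrow> ('a \<Rightarrow> 'a) \<Rightarrow> real \<Rightarrow> real \<Rightarrow> real \<Rightarrow> 'a \<times> 'a \<Rightarrow> 'a \<times> 'a" where
  "vi_field K F \<alpha> lam \<zeta> = (\<lambda>(x, y).
     (rho K F lam \<zeta> x y *\<^sub>R (closest_point K (x - \<alpha> *\<^sub>R F y) - x),
      rho K F lam \<zeta> x y *\<^sub>R (closest_point K (x - \<alpha> *\<^sub>R F x) - y)))"

end

theory Submission
  imports Defs
begin

text \<open>
  The Lyapunov function is \<open>W (x, y) = dist\<^sup>2 (x, Sol) + \<parallel>x - y\<parallel>\<^sup>2\<close>. It need not be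
  differentiable, but if \<open>v\<close> is a solution nearest to \<open>x(t)\<close>, then
  \<open>s \<mapsto> \<parallel>x(s) - v\<parallel>\<^sup>2 + \<parallel>x(s) - y(s)\<parallel>\<^sup>2\<close> majorises \<open>W\<close> along the trajectory and touches it at \<open>t\<close>,
  and its derivative there is at most \<open>- 2 d \<rho> W\<close>. Since \<open>v\<close> is a fixed point of
  \<open>x \<mapsto> \<Pi>\<^sub>K (x - \<lambda> F x)\<close>, which contracts the distance to \<open>v\<close> by the factor \<open>c\<close>, one has
  \<open>(1 - c)\<^sup>2 W \<le> S\<^sub>\<lambda> \<le> (1 + c)\<^sup>2 W\<close>. Hence \<open>W' \<le> - 2 d (1 - c) W\<^bsup>3/2\<^esup>\<close> brings \<open>W\<close> below 2
  within the first summand of the time bound, whatever its initial value, and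
  \<open>W' \<le> - 2 d (1 + c)\<^bsup>2\<zeta>-1\<^esup> W\<^bsup>\<zeta>+1/2\<^esup>\<close> then brings it to 0 within the second.
\<close>

section \<open>One-sided differential inequalities\<close>

text \<open>With slack \<open>e\<close> in the slope, the times at which \<open>\<phi>\<close> lies
  below the line of slope \<open>- (k - e)\<close> form a compact set. At its largest element
  \<open>s\<close> a majorant touching from above would carry the inequality slightly to the right
  of \<open>s\<close>, so \<open>s = b\<close>; then the slack is sent to 0.\<close>

lemma decrease_of_right_majorants:
  fixes \<phi> :: "real \<Rightarrow> real"
  assumes "a \<le> b" and cont: "continuous_on {a..b} \<phi>"
    and maj: "\<And>t. a \<le> t \<Longrightarrow> t < b \<Longrightarrow> \<exists>\<psi> D. (\<psi> has_real_derivative D) (at t within {t..})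
        \<and> D \<le> - k \<and> \<psi> t = \<phi> t \<and> (\<forall>s\<in>{t..b}. \<phi> s \<le> \<psi> s)"
  shows "\<phi> b \<le> \<phi> a - k * (b - a)"
proof (rule field_le_epsilon)
  fix e' :: real assume "e' > 0"
  \<comment> \<open>The \<open>+ 1\<close> keeps the denominator positive when
    \<open>a = b\<close>.\<close>
  define e where "e = e' / (b - a + 1)"
  have e: "e > 0" "e * (b - a) \<le> e'"
    using \<open>e' > 0\<close> \<open>a \<le> b\<close> by (auto simp: e_def field_simps)
  define A where "A = {t \<in> {a..b}. \<phi> t \<le> \<phi> a - (k - e) * (t - a)}"
  have "closed A"
    unfolding A_def by (intro continuous_on_closed_Collect_le continuous_intros cont)
  moreover have "A \<subseteq> {a..b}" by (auto simp: A_def)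
  ultimately have "compact A"
    using compact_Int_closed[of "{a..b}" A] by (simp add: Int_absorb1)
  moreover have "a \<in> A" using \<open>a \<le> b\<close> by (auto simp: A_def)
  ultimately obtain s where s: "s \<in> A" "\<And>t. t \<in> A \<Longrightarrow> t \<le> s"
    using compact_attains_sup[of A] by auto
  have "s = b"
  proof (rule ccontr)
    assume "s \<noteq> b"
    then have sb: "a \<le> s" "s < b" using s(1) by (auto simp: A_def)
    obtain \<psi> D where \<psi>: "(\<psi> has_real_derivative D) (at s within {s..})" "D \<le> - k"
      "\<psi> s = \<phi> s" "\<forall>t\<in>{s..b}. \<phi> t \<le> \<psi> t"
      using maj[OF sb] by blast
    have "((\<lambda>t. (\<psi> t - \<psi> s) / (t - s)) \<longlongrightarrow> D) (at s within {s..})"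
      using \<psi>(1) by (simp add: has_field_derivative_iff)
    then have "eventually (\<lambda>t. (\<psi> t - \<psi> s) / (t - s) < D + e) (at s within {s..})"
      using e(1) by (intro order_tendstoD) auto
    then obtain \<delta> where \<delta>: "\<delta> > 0"
      "\<And>t. t \<in> {s..} \<Longrightarrow> t \<noteq> s \<Longrightarrow> dist t s < \<delta> \<Longrightarrow> (\<psi> t - \<psi> s) / (t - s) < D + e"
      by (auto simp: eventually_at)
    define t where "t = s + min (\<delta> / 2) (b - s)"
    have t: "s < t" "t \<le> b" "dist t s < \<delta>"
      using sb \<delta>(1) by (auto simp: t_def dist_real_def min_def)
    then have "(\<psi> t - \<psi> s) / (t - s) < D + e" by (intro \<delta>(2)) auto
    then have "\<psi> t - \<psi> s \<le> (D + e) * (t - s)" using t by (simp add: field_simps)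
    also have "\<dots> \<le> (e - k) * (t - s)" using \<psi>(2) t by (intro mult_right_mono) auto
    finally have "\<phi> t \<le> \<phi> s + (e - k) * (t - s)"
      using \<psi>(3,4) t by (smt (verit) atLeastAtMost_iff)
    moreover have "\<phi> s \<le> \<phi> a - (k - e) * (s - a)" using s(1) by (auto simp: A_def)
    ultimately have "\<phi> t \<le> \<phi> a - (k - e) * (t - a)" by (simp add: algebra_simps)
    then have "t \<in> A" using t sb by (auto simp: A_def)
    then show False using s(2) t by fastforce
  qed
  then have "\<phi> b \<le> \<phi> a - (k - e) * (b - a)" using s(1) by (auto simp: A_def)
  then show "\<phi> b \<le> \<phi> a - k * (b - a) + e'" using e(2) by (simp add: algebra_simps)
qed

text \<open>Change of variables: as \<open>g\<close> is nondecreasing, majorants of \<open>W\<close>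
  become majorants of \<open>g (W t)\<close>, and a nonlinear inequality for \<open>W\<close> turns
  into a constant rate. Positivity of \<open>W\<close> keeps the argument where \<open>g\<close> is
  differentiable.\<close>

lemma decrease_of_right_majorants_compose:
  fixes W g g' :: "real \<Rightarrow> real"
  assumes "a \<le> b" and cont: "continuous_on {a..b} W"
    and pos: "\<And>t. a \<le> t \<Longrightarrow> t \<le> b \<Longrightarrow> W t > 0"
    and maj: "\<And>t. a \<le> t \<Longrightarrow> t < b \<Longrightarrow> \<exists>\<psi> D. (\<psi> has_real_derivative D) (at t within {t..})
        \<and> g' (W t) * D \<le> - k \<and> \<psi> t = W t \<and> (\<forall>s\<in>{t..b}. W s \<le> \<psi> s)"
    and deriv: "\<And>w. 0 < w \<Longrightarrow> (g has_real_derivative g' w) (at w)"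
    and nonneg: "\<And>w. 0 < w \<Longrightarrow> g' w \<ge> 0"
  shows "g (W b) \<le> g (W a) - k * (b - a)"
proof (rule decrease_of_right_majorants[where \<phi> = "\<lambda>t. g (W t)"])
  have "continuous_on {0<..} g"
    by (auto intro!: continuous_at_imp_continuous_on DERIV_isCont deriv)
  then show "continuous_on {a..b} (\<lambda>t. g (W t))"
    by (rule continuous_on_compose2[OF _ cont]) (auto intro: pos)
  have mono: "g v \<le> g w" if "0 < v" "v \<le> w" for v w
    using that by (intro DERIV_nonneg_imp_nondecreasing[of v w g]) (auto intro!: deriv nonneg exI)
  fix t assume t: "a \<le> t" "t < b"
  obtain \<psi> D where \<psi>: "(\<psi> has_real_derivative D) (at t within {t..})" "g' (W t) * D \<le> - k"
    "\<psi> t = W t" "\<forall>s\<in>{t..b}. W s \<le> \<psi> s"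
    using maj[OF t] by blast
  have "((\<lambda>s. g (\<psi> s)) has_real_derivative g' (W t) * D) (at t within {t..})"
    using DERIV_chain2[of g "g' (W t)" \<psi> t D "{t..}"] \<psi>(1,3) deriv[OF pos[of t]] t by simp
  moreover have "\<forall>s\<in>{t..b}. g (W s) \<le> g (\<psi> s)"
    using \<psi>(4) t by (auto intro!: mono pos)
  ultimately show "\<exists>\<psi> D. (\<psi> has_real_derivative D) (at t within {t..})
        \<and> D \<le> - k \<and> \<psi> t = g (W t) \<and> (\<forall>s\<in>{t..b}. g (W s) \<le> \<psi> s)"
    using \<psi>(2,3) by (intro exI[of _ "\<lambda>s. g (\<psi> s)"] exI[of _ "g' (W t) * D"]) auto
qed fact

section \<open>Quadratic estimate behind the dissipation\<close>

text \<open>Used with \<open>u = x - v\<close>, \<open>w = x - y\<close>, \<open>s = x - q\<close>,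
  \<open>r = q - p\<close>, \<open>a = \<alpha> * L\<close>, while \<open>g\<close> and
  \<open>h\<close> are \<open>\<alpha>\<close> times increments of \<open>F\<close>. Completing the
  square eliminates \<open>s\<close>; what remains delicate is the product of \<open>g\<close> with
  \<open>h\<close> / 2 - \<open>u\<close>, which couples the two distances.\<close>

lemma extragradient_quadratic_bound:
  fixes u w g h s r :: "'a::real_inner"
  assumes a: "0 \<le> a" "a \<le> 1 / 2"
    and h: "norm h \<le> a * norm u" "b \<le> h \<bullet> u" "0 \<le> b"
    and g: "norm g \<le> a * norm w" and r: "norm r \<le> a * norm w"
  shows "(g + h) \<bullet> (s - u) - s \<bullet> s + w \<bullet> (r - w)
    \<le> - b + a\<^sup>2 * (norm u)\<^sup>2 - (1 / 2 - a) * (norm w)\<^sup>2"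
proof -
  define D e where "D = norm u" and "e = norm w"
  have De: "D \<ge> 0" "e \<ge> 0" by (auto simp: D_def e_def)
  have a2: "a\<^sup>2 \<le> 1 / 4" using power_mono[OF a(2,1), of 2] by (simp add: power2_eq_square)
  have hh: "h \<bullet> h \<le> a\<^sup>2 * D\<^sup>2"
    using power_mono[OF h(1) norm_ge_zero, of 2] by (simp add: D_def dot_square_norm power_mult_distrib)
  have gg: "g \<bullet> g \<le> a\<^sup>2 * e\<^sup>2"
    using power_mono[OF g norm_ge_zero, of 2] by (simp add: e_def dot_square_norm power_mult_distrib)
  have wr: "w \<bullet> r \<le> a * e\<^sup>2"
  proof -
    have "w \<bullet> r \<le> norm w * norm r" by (rule norm_cauchy_schwarz)
    also have "\<dots> \<le> norm w * (a * norm w)" using r by (intro mult_left_mono) auto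
    finally show ?thesis by (simp add: e_def power2_eq_square mult.left_commute)
  qed
  have "0 \<le> (s - (1/2) *\<^sub>R (g + h)) \<bullet> (s - (1/2) *\<^sub>R (g + h))" by simp
  then have complete_square: "(g + h) \<bullet> s - s \<bullet> s \<le> (g + h) \<bullet> (g + h) / 4"
    by (simp add: inner_diff_left inner_diff_right inner_add_left inner_add_right inner_commute
        field_simps)
  \<comment> \<open>The mixed term has a favourable sign because \<open>h \<bullet> u\<close> is at
    least \<open>b \<ge> 0\<close>; the constant 11/10 works since 1 + 1/16 is below its
    square.\<close>
  have "(norm ((1/2) *\<^sub>R h - u))\<^sup>2 = h \<bullet> h / 4 - h \<bullet> u + D\<^sup>2"
    by (simp add: D_def power2_norm_eq_inner inner_diff_left inner_diff_right inner_commute)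
  also have "\<dots> \<le> a\<^sup>2 * D\<^sup>2 / 4 + D\<^sup>2" using hh h(2,3) by linarith
  also have "\<dots> \<le> (1 / 4) * D\<^sup>2 / 4 + D\<^sup>2" using mult_right_mono[OF a2, of "D\<^sup>2"] by (simp add: mult.commute)
  also have "\<dots> \<le> (11 / 10 * D)\<^sup>2" by (simp add: power_mult_distrib power2_eq_square)
  finally have "norm ((1/2) *\<^sub>R h - u) \<le> 11 / 10 * D"
    using De by (auto intro: power2_le_imp_le)
  then have "g \<bullet> ((1/2) *\<^sub>R h - u) \<le> (a * e) * (11 / 10 * D)"
    using g a De by (intro order.trans[OF norm_cauchy_schwarz] mult_mono) (auto simp: e_def)
  \<comment> \<open>Young's inequality with the weights still available: 3/4 completes the 1/4 from
    \<open>h \<bullet> h / 4\<close>, and 7/16 is the least value of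
    \<open>1 / 2 - a\<^sup>2 / 4\<close> for \<open>a \<le> 1 / 2\<close>.\<close>
  also have "\<dots> \<le> (3 / 4) * (a * D)\<^sup>2 + (7 / 16) * e\<^sup>2"
  proof -
    have "0 \<le> (3 / 4) * (a * D - 11 / 15 * e)\<^sup>2 + 41 / 1200 * e\<^sup>2" by simp
    then show ?thesis by (simp add: power2_eq_square algebra_simps)
  qed
  also have "\<dots> \<le> (3 / 4) * a\<^sup>2 * D\<^sup>2 + (1 / 2 - a\<^sup>2 / 4) * e\<^sup>2"
    using mult_right_mono[of "7 / 16" "1 / 2 - a\<^sup>2 / 4" "e\<^sup>2"] a2 by (simp add: power_mult_distrib)
  finally have cross: "g \<bullet> ((1/2) *\<^sub>R h - u) \<le> (3 / 4) * a\<^sup>2 * D\<^sup>2 + (1 / 2 - a\<^sup>2 / 4) * e\<^sup>2" .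
  have "(g + h) \<bullet> (s - u) - s \<bullet> s + w \<bullet> (r - w)
      \<le> (g + h) \<bullet> (g + h) / 4 - (g + h) \<bullet> u + w \<bullet> r - w \<bullet> w"
    using complete_square by (simp add: inner_diff_right)
  also have "\<dots> = h \<bullet> h / 4 - h \<bullet> u + g \<bullet> ((1/2) *\<^sub>R h - u) + g \<bullet> g / 4 + w \<bullet> r - e\<^sup>2"
    by (simp add: e_def power2_norm_eq_inner inner_diff_right inner_add_left inner_add_right
        inner_commute[of h g] field_simps)
  also have "\<dots> \<le> a\<^sup>2 * D\<^sup>2 / 4 - b + ((3 / 4) * a\<^sup>2 * D\<^sup>2 + (1 / 2 - a\<^sup>2 / 4) * e\<^sup>2)
      + a\<^sup>2 * e\<^sup>2 / 4 + a * e\<^sup>2 - e\<^sup>2"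
    using hh gg wr cross h(2) by linarith
  also have "\<dots> = - b + a\<^sup>2 * D\<^sup>2 - (1 / 2 - a) * e\<^sup>2" by (simp add: field_simps)
  finally show ?thesis by (simp add: D_def e_def)
qed

section \<open>Setting, Lyapunov function and distance to the solution set\<close>

text \<open>Here \<open>c\<close> is any number in [0, 1) whose square dominates the radicand, not a
  fixed square root, so that a negative radicand is covered too. The upper bound on
  \<open>lam\<close> is encoded in \<open>c < 1\<close>.\<close>

locale extragradient_flow =
  fixes K :: "'a::euclidean_space set" and F :: "'a \<Rightarrow> 'a" and L \<eta> \<alpha> lam \<zeta> c :: real
  assumes K: "closed K" "convex K"
    and L: "L > 0" "L-lipschitz_on K F"
    and Sol: "VI_sol K F \<noteq> {}"
    and \<eta>: "\<eta> > 0"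
    and mono: "\<And>x. x \<in> K \<Longrightarrow> \<exists>v\<in>nearest_points (closure (VI_sol K F)) x.
        (F x - F v) \<bullet> (x - v) \<ge> \<eta> * (infdist x (VI_sol K F))\<^sup>2"
    and \<alpha>: "0 < \<alpha>" "\<alpha> < \<eta> / L\<^sup>2" "\<alpha> < 1 / (2 * L)"
    and lam: "0 < lam"
    and \<zeta>: "0 < \<zeta>" "\<zeta> < 1 / 2"
    and c: "0 \<le> c" "c < 1" "1 - 2 * lam * \<eta> + lam\<^sup>2 * L\<^sup>2 \<le> c\<^sup>2"
begin

abbreviation "f \<equiv> vi_field K F \<alpha> lam \<zeta>"
abbreviation "M \<equiv> {(u, u) | u. u \<in> VI_sol K F}"

definition d where "d = min (\<alpha> * (\<eta> - \<alpha> * L\<^sup>2)) (1 / 2 - \<alpha> * L)"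

definition W :: "'a \<times> 'a \<Rightarrow> real" where
  "W z = (infdist (fst z) (VI_sol K F))\<^sup>2 + (norm (fst z - snd z))\<^sup>2"

lemma d_pos: "d > 0"
  using L \<alpha> by (auto simp: d_def field_simps)

lemma W_nonneg: "W z \<ge> 0"
  by (simp add: W_def)

lemma lipschitz: "x \<in> K \<Longrightarrow> y \<in> K \<Longrightarrow> norm (F x - F y) \<le> L * norm (x - y)"
  using lipschitz_onD[OF L(2)] by (simp add: dist_norm)

lemma proj_le: "y \<in> K \<Longrightarrow> (x - closest_point K x) \<bullet> (y - closest_point K x) \<le> 0"
  by (rule closest_point_dot[OF K(2,1)])

text \<open>Closedness removes the closure from \<open>mono\<close> and makes the distance to the
  solution set attained.\<close>

lemma closed_Sol: "closed (VI_sol K F)"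
proof -
  have "continuous_on K F" using L(2) by (rule lipschitz_on_continuous_on)
  then have "closed {u \<in> K. 0 \<le> F u \<bullet> (x - u)}" for x
    by (intro continuous_on_closed_Collect_le continuous_intros K)
  moreover have "VI_sol K F = K \<inter> (\<Inter>x\<in>K. {u \<in> K. 0 \<le> F u \<bullet> (x - u)})"
    by (auto simp: VI_sol_def)
  ultimately show ?thesis using K by (auto intro!: closed_Int closed_INT)
qed

lemma closed_M: "closed M"
proof -
  have "M = (VI_sol K F \<times> VI_sol K F) \<inter> {z. fst z = snd z}" by auto
  then show ?thesis
    by (auto intro!: closed_Int closed_Times closed_Sol closed_Collect_eq continuous_intros)
qed

lemma W_zero_iff: "W z = 0 \<longleftrightarrow> z \<in> M"
  using in_closed_iff_infdist_zero[OF closed_Sol Sol]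
  by (cases z) (auto simp: W_def add_nonneg_eq_0_iff)

text \<open>Compare with \<open>(v, v)\<close> for a solution \<open>v\<close> nearest to the first
  component; the triangle inequality bounds the second component. Together with
  \<open>W_le_nbhd\<close> this translates between \<open>W\<close> and neighbourhoods of
  \<open>M\<close>.\<close>

lemma infdist_M_le: "infdist z M \<le> 2 * sqrt (W z)"
proof -
  obtain v where v: "v \<in> VI_sol K F" "infdist (fst z) (VI_sol K F) = dist (fst z) v"
    using infdist_attains_inf[OF closed_Sol Sol] by metis
  have "norm (snd z - v) \<le> norm (fst z - v) + norm (fst z - snd z)"
    using norm_triangle_ineq4[of "fst z - v" "fst z - snd z"] by simp
  then have "(norm (snd z - v))\<^sup>2 \<le> (norm (fst z - v) + norm (fst z - snd z))\<^sup>2"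
    by (intro power_mono) auto
  also have "\<dots> \<le> 2 * (norm (fst z - v))\<^sup>2 + 2 * (norm (fst z - snd z))\<^sup>2"
    using zero_le_power2[of "norm (fst z - v) - norm (fst z - snd z)"]
    by (simp add: power2_eq_square algebra_simps)
  finally have "(dist z (v, v))\<^sup>2 \<le> 4 * W z"
    using v(2) by (cases z)
      (simp add: dist_Pair_Pair W_def flip: dist_norm, smt (verit) zero_le_power2)
  then have "dist z (v, v) \<le> sqrt (4 * W z)" by (rule real_le_rsqrt)
  moreover have "infdist z M \<le> dist z (v, v)" using v(1) by (intro infdist_le) auto
  ultimately show ?thesis by (simp add: real_sqrt_mult)
qed

text \<open>Both components lie within \<open>\<delta>\<close> of one solution, hence within
  \<open>2 * \<delta>\<close> of each other; 5 is 1 + 4.\<close>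

lemma W_le_nbhd:
  assumes "z \<in> nbhd M \<delta>" shows "W z \<le> 5 * \<delta>\<^sup>2"
proof -
  have "M \<noteq> {}" using Sol by auto
  obtain w where w: "w \<in> M" "infdist z M = dist z w"
    using infdist_attains_inf[OF closed_M \<open>M \<noteq> {}\<close>, of z] by blast
  obtain u where "u \<in> VI_sol K F" "w = (u, u)" using w(1) by blast
  moreover have "dist z w < \<delta>" using assms w(2) by (simp only: nbhd_def mem_Collect_eq)
  ultimately have u: "u \<in> VI_sol K F" "dist z (u, u) < \<delta>" by simp_all
  have x: "dist (fst z) u \<le> \<delta>" and y: "dist (snd z) u \<le> \<delta>"
    using u(2) dist_fst_le[of z "(u, u)"] dist_snd_le[of z "(u, u)"] by auto
  have "infdist (fst z) (VI_sol K F) \<le> \<delta>" using infdist_le2[OF u(1) x] .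
  moreover have "norm (fst z - snd z) \<le> 2 * \<delta>"
    using x y dist_triangle2[of "fst z" "snd z" u] by (simp add: dist_norm)
  ultimately have "(infdist (fst z) (VI_sol K F))\<^sup>2 \<le> \<delta>\<^sup>2" "(norm (fst z - snd z))\<^sup>2 \<le> (2 * \<delta>)\<^sup>2"
    by (simp_all only: power_mono infdist_nonneg norm_ge_zero)
  then show ?thesis by (simp add: W_def power_mult_distrib)
qed

lemma nearest_solution:
  assumes "x \<in> K"
  obtains v where "v \<in> VI_sol K F" "v \<in> K" "norm (x - v) = infdist x (VI_sol K F)"
    "(F x - F v) \<bullet> (x - v) \<ge> \<eta> * (norm (x - v))\<^sup>2" "\<forall>y\<in>K. F v \<bullet> (y - v) \<ge> 0"
proof -
  obtain v where v: "v \<in> VI_sol K F" "dist x v = infdist x (VI_sol K F)"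
    "(F x - F v) \<bullet> (x - v) \<ge> \<eta> * (infdist x (VI_sol K F))\<^sup>2"
    using mono[OF assms] unfolding nearest_points_def closure_closed[OF closed_Sol] by blast
  have sol: "v \<in> K" "\<forall>y\<in>K. F v \<bullet> (y - v) \<ge> 0"
    using v(1) by (auto simp: VI_sol_def)
  show ?thesis using that[OF v(1) sol(1) _ _ sol(2)] v(2,3) by (simp add: dist_norm)
qed

section \<open>Projection residual and lower bounds for the gain\<close>

text \<open>Expanding the square, the \<open>\<eta>\<close>-inequality and the Lipschitz bound show
  that the unprojected step already contracts the distance to \<open>v\<close> by \<open>c\<close>;
  projection is nonexpansive and fixes the image of \<open>v\<close>. Two triangle inequalities
  finish.\<close>

lemma residual_bounds:
  assumes "x \<in> K"
  defines "R \<equiv> norm (x - closest_point K (x - lam *\<^sub>R F x))"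
  shows "(1 - c) * infdist x (VI_sol K F) \<le> R" "R \<le> (1 + c) * infdist x (VI_sol K F)"
proof -
  obtain v where v: "v \<in> VI_sol K F" "v \<in> K" "norm (x - v) = infdist x (VI_sol K F)"
    "(F x - F v) \<bullet> (x - v) \<ge> \<eta> * (norm (x - v))\<^sup>2" "\<forall>y\<in>K. F v \<bullet> (y - v) \<ge> 0"
    by (rule nearest_solution[OF assms(1)])
  \<comment> \<open>Test the projection inequality with \<open>v\<close> and the solution inequality
    with the projected point: their sum forces the distance between the two points to
    vanish.\<close>
  have fixed: "closest_point K (v - lam *\<^sub>R F v) = v"
  proof -
    let ?p = "closest_point K (v - lam *\<^sub>R F v)"
    have "?p \<in> K" using K(1) v(2) by (auto intro: closest_point_in_set)
    then have "lam * (F v \<bullet> (?p - v)) \<ge> 0" using v(5) lam by simp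
    moreover have "(v - lam *\<^sub>R F v - ?p) \<bullet> (v - ?p) \<le> 0" by (rule proj_le[OF v(2)])
    ultimately have "(v - ?p) \<bullet> (v - ?p) \<le> 0"
      by (simp add: inner_diff_left inner_diff_right algebra_simps)
    then have "(v - ?p) \<bullet> (v - ?p) = 0" using inner_ge_zero by (meson antisym)
    then show ?thesis by simp
  qed
  have "(norm ((x - lam *\<^sub>R F x) - (v - lam *\<^sub>R F v)))\<^sup>2
      = (norm (x - v))\<^sup>2 - 2 * lam * ((F x - F v) \<bullet> (x - v)) + lam\<^sup>2 * (norm (F x - F v))\<^sup>2"
    unfolding power2_norm_eq_inner
    by (simp add: inner_diff_left inner_diff_right inner_commute power2_eq_square algebra_simps)
  also have "\<dots> \<le> (norm (x - v))\<^sup>2 - 2 * lam * (\<eta> * (norm (x - v))\<^sup>2)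
      + lam\<^sup>2 * (L * norm (x - v))\<^sup>2"
    using v(2,4) lam lipschitz[OF assms(1) v(2)]
    by (intro add_mono diff_left_mono mult_left_mono power_mono) auto
  also have "\<dots> = (1 - 2 * lam * \<eta> + lam\<^sup>2 * L\<^sup>2) * (norm (x - v))\<^sup>2"
    by (simp add: algebra_simps power_mult_distrib)
  also have "\<dots> \<le> (c * norm (x - v))\<^sup>2"
    using c(3) by (simp add: power_mult_distrib mult_right_mono)
  finally have "norm ((x - lam *\<^sub>R F x) - (v - lam *\<^sub>R F v)) \<le> c * norm (x - v)"
    using c by (auto intro: power2_le_imp_le)
  moreover have "norm (closest_point K (x - lam *\<^sub>R F x) - v)
      \<le> norm ((x - lam *\<^sub>R F x) - (v - lam *\<^sub>R F v))"
    using closest_point_lipschitz[OF K(2,1), of "x - lam *\<^sub>R F x" "v - lam *\<^sub>R F v"] v(2) fixed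
    by (auto simp: dist_norm)
  ultimately have p: "norm (closest_point K (x - lam *\<^sub>R F x) - v) \<le> c * norm (x - v)" by simp
  let ?p = "closest_point K (x - lam *\<^sub>R F x)"
  have "norm (x - v) \<le> R + norm (?p - v)"
    unfolding R_def using norm_triangle_ineq[of "x - ?p" "?p - v"] by simp
  moreover have "R \<le> norm (x - v) + norm (?p - v)"
    unfolding R_def using norm_triangle_ineq4[of "x - v" "?p - v"] by simp
  ultimately show "(1 - c) * infdist x (VI_sol K F) \<le> R" "R \<le> (1 + c) * infdist x (VI_sol K F)"
    using p by (auto simp: v(3)[symmetric] algebra_simps)
qed

lemma S_res_bounds:
  assumes "x \<in> K"
  shows "(1 - c)\<^sup>2 * W (x, y) \<le> S_res K F lam x y" "S_res K F lam x y \<le> (1 + c)\<^sup>2 * W (x, y)"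
proof -
  let ?R = "norm (x - closest_point K (x - lam *\<^sub>R F x))" and ?D = "infdist x (VI_sol K F)"
  have "((1 - c) * ?D)\<^sup>2 \<le> ?R\<^sup>2" "?R\<^sup>2 \<le> ((1 + c) * ?D)\<^sup>2"
    using residual_bounds[OF assms] c by (auto intro!: power_mono mult_nonneg_nonneg infdist_nonneg)
  moreover have "(1 - c)\<^sup>2 * (norm (x - y))\<^sup>2 \<le> 1 * (norm (x - y))\<^sup>2"
    using c by (intro mult_right_mono) (auto intro: power_le_one)
  moreover have "1 * (norm (x - y))\<^sup>2 \<le> (1 + c)\<^sup>2 * (norm (x - y))\<^sup>2"
    using c by (intro mult_right_mono) auto
  ultimately show "(1 - c)\<^sup>2 * W (x, y) \<le> S_res K F lam x y"
    "S_res K F lam x y \<le> (1 + c)\<^sup>2 * W (x, y)"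
    by (auto simp: W_def S_res_def power_mult_distrib distrib_left)
qed

lemma rho_nonneg: "rho K F lam \<zeta> x y \<ge> 0"
  by (simp add: rho_def)

text \<open>Each bound drops one summand of \<open>rho\<close>. The power 1/2 is increasing and uses
  the lower bound on \<open>S_res\<close>; the power \<open>\<zeta> - 1 / 2\<close> is decreasing
  and uses the upper one.\<close>

lemma rho_lower_bounds:
  assumes "x \<in> K" "W (x, y) > 0"
  shows "rho K F lam \<zeta> x y \<ge> (1 - c) * W (x, y) powr (1 / 2)"
    and "rho K F lam \<zeta> x y \<ge> (1 + c) powr (2 * \<zeta> - 1) * W (x, y) powr (\<zeta> - 1 / 2)"
proof -
  let ?S = "S_res K F lam x y" and ?W = "W (x, y)"
  have pos: "0 < (1 - c)\<^sup>2 * ?W" using assms(2) c by simp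
  then have S: "?S > 0" using S_res_bounds(1)[OF assms(1), of y] by linarith
  have sq: "(b\<^sup>2) powr p = b powr (2 * p)" if "b > 0" for b p :: real
    using that by (simp add: powr_powr flip: powr_numeral)
  have "(1 - c) * ?W powr (1 / 2) = ((1 - c)\<^sup>2 * ?W) powr (1 / 2)"
    using assms(2) c by (simp add: powr_mult sq)
  also have "\<dots> \<le> ?S powr (1 / 2)"
    using S_res_bounds(1)[OF assms(1)] pos by (intro powr_mono2) auto
  finally show "rho K F lam \<zeta> x y \<ge> (1 - c) * ?W powr (1 / 2)"
    using S by (simp add: rho_def add_increasing2)
  have "(1 + c) powr (2 * \<zeta> - 1) * ?W powr (\<zeta> - 1 / 2) = ((1 + c)\<^sup>2 * ?W) powr (\<zeta> - 1 / 2)"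
    using assms(2) c by (simp add: powr_mult sq algebra_simps)
  also have "\<dots> \<le> ?S powr (\<zeta> - 1 / 2)"
    using S_res_bounds(2)[OF assms(1)] S \<zeta> by (intro powr_mono2') auto
  finally show "rho K F lam \<zeta> x y \<ge> (1 + c) powr (2 * \<zeta> - 1) * ?W powr (\<zeta> - 1 / 2)"
    using S by (simp add: rho_def add_increasing)
qed

section \<open>Dissipation along the vector field\<close>

text \<open>The left-hand side is half the derivative of the majorant, with \<open>rho\<close>
  factored out.\<close>

lemma field_dissipation:
  assumes "x \<in> K" "y \<in> K"
  defines "p \<equiv> closest_point K (x - \<alpha> *\<^sub>R F x)" and "q \<equiv> closest_point K (x - \<alpha> *\<^sub>R F y)"
  obtains v where "v \<in> VI_sol K F" "norm (x - v) = infdist x (VI_sol K F)"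
    "(x - v) \<bullet> (q - x) + (x - y) \<bullet> ((q - x) - (p - y)) \<le> - d * W (x, y)"
proof -
  obtain v where v: "v \<in> VI_sol K F" "v \<in> K" "norm (x - v) = infdist x (VI_sol K F)"
    "(F x - F v) \<bullet> (x - v) \<ge> \<eta> * (norm (x - v))\<^sup>2" "\<forall>y\<in>K. F v \<bullet> (y - v) \<ge> 0"
    by (rule nearest_solution[OF assms(1)])
  have qK: "q \<in> K" unfolding q_def using K assms(1) by (auto intro: closest_point_in_set)
  let ?g = "\<alpha> *\<^sub>R (F y - F x)" and ?h = "\<alpha> *\<^sub>R (F x - F v)"
  have qp: "norm (q - p) \<le> \<alpha> * L * norm (x - y)"
  proof -
    have "norm (q - p) \<le> norm ((x - \<alpha> *\<^sub>R F y) - (x - \<alpha> *\<^sub>R F x))"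
      unfolding q_def p_def unfolding dist_norm[symmetric]
      using assms(1) by (intro closest_point_lipschitz[OF K(2,1)]) auto
    also have "\<dots> = \<alpha> * norm (F x - F y)" using \<alpha> by (simp flip: scaleR_diff_right)
    finally show ?thesis
      using mult_left_mono[OF lipschitz[OF assms(1,2)], of \<alpha>] \<alpha> unfolding mult.assoc by linarith
  qed
  \<comment> \<open>The projection inequality at \<open>q\<close> is tested with \<open>v\<close>,
    and the solution inequality at \<open>v\<close> with \<open>q\<close>; adding them replaces
    \<open>F y\<close> by \<open>F y - F v\<close>, which splits into
    \<open>?g + ?h\<close>.\<close>
  have "(x - \<alpha> *\<^sub>R F y - q) \<bullet> (v - q) \<le> 0"
    unfolding q_def by (rule proj_le[OF v(2)])
  moreover have "\<alpha> * (F v \<bullet> (q - v)) \<ge> 0" using v(5) qK \<alpha> by simp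
  ultimately have "(x - v) \<bullet> (q - x) \<le> (?g + ?h) \<bullet> ((x - q) - (x - v)) - (x - q) \<bullet> (x - q)"
    by (simp add: inner_diff_left inner_diff_right inner_add_left inner_commute algebra_simps)
  then have "(x - v) \<bullet> (q - x) + (x - y) \<bullet> ((q - x) - (p - y))
    \<le> (?g + ?h) \<bullet> ((x - q) - (x - v)) - (x - q) \<bullet> (x - q) + (x - y) \<bullet> ((q - p) - (x - y))"
    by (simp add: algebra_simps)
  also have "\<dots> \<le> - (\<alpha> * \<eta> * (norm (x - v))\<^sup>2) + (\<alpha> * L)\<^sup>2 * (norm (x - v))\<^sup>2
      - (1 / 2 - \<alpha> * L) * (norm (x - y))\<^sup>2"
  proof (rule extragradient_quadratic_bound)
    show "\<alpha> * L \<le> 1 / 2" using \<alpha>(3) L by (simp add: field_simps)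
    show "norm ?h \<le> \<alpha> * L * norm (x - v)" "norm ?g \<le> \<alpha> * L * norm (x - y)"
      using lipschitz[OF assms(1) v(2)] lipschitz[OF assms(2,1)] \<alpha>
      by (auto simp: mult.assoc norm_minus_commute)
    show "\<alpha> * \<eta> * (norm (x - v))\<^sup>2 \<le> ?h \<bullet> (x - v)"
      using mult_left_mono[OF v(4), of \<alpha>] \<alpha> by (simp add: mult.assoc)
  qed (use qp \<alpha> \<eta> L in auto)
  also have "\<dots> = - (\<alpha> * (\<eta> - \<alpha> * L\<^sup>2) * (norm (x - v))\<^sup>2 + (1 / 2 - \<alpha> * L) * (norm (x - y))\<^sup>2)"
    by (simp add: algebra_simps power2_eq_square)
  also have "\<dots> \<le> - (d * (norm (x - v))\<^sup>2 + d * (norm (x - y))\<^sup>2)"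
    unfolding neg_le_iff_le by (intro add_mono mult_right_mono) (auto simp: d_def)
  also have "\<dots> = - d * W (x, y)" by (simp add: W_def v(3) algebra_simps)
  finally show ?thesis using that v by blast
qed

section \<open>Evolution of \<open>W\<close> along a trajectory\<close>

context
  fixes z assumes z: "solution f (K \<times> K) z"
begin

lemma solution_continuous: "continuous_on {0..} z"
  using z by (auto simp: solution_def intro!: continuous_on_eq_continuous_within[THEN iffD2]
      has_vector_derivative_continuous)

lemma W_continuous: "continuous_on {0..} (\<lambda>t. W (z t))"
  unfolding W_def by (intro continuous_intros solution_continuous)

lemma W_majorant:
  assumes "t \<ge> 0"
  shows "\<exists>\<psi> D. (\<psi> has_real_derivative D) (at t within {t..})
    \<and> D \<le> - 2 * d * rho K F lam \<zeta> (fst (z t)) (snd (z t)) * W (z t)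
    \<and> \<psi> t = W (z t) \<and> (\<forall>s. W (z s) \<le> \<psi> s)"
proof -
  define x y where "x = (\<lambda>s. fst (z s))" and "y = (\<lambda>s. snd (z s))"
  define r where "r = rho K F lam \<zeta> (x t) (y t)"
  define p q where "p = closest_point K (x t - \<alpha> *\<^sub>R F (x t))"
    and "q = closest_point K (x t - \<alpha> *\<^sub>R F (y t))"
  \<comment> \<open>Only the right derivative is kept, so \<open>t = 0\<close> needs no separate
    treatment.\<close>
  have zt: "z t \<in> K \<times> K" "(z has_vector_derivative f (z t)) (at t within {t..})"
    using z assms by (auto simp: solution_def intro: has_vector_derivative_within_subset)
  then have xy: "x t \<in> K" "y t \<in> K" by (auto simp: x_def y_def mem_Times_iff)
  obtain v where v: "v \<in> VI_sol K F" "norm (x t - v) = infdist (x t) (VI_sol K F)"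
    "(x t - v) \<bullet> (q - x t) + (x t - y t) \<bullet> ((q - x t) - (p - y t)) \<le> - d * W (x t, y t)"
    using field_dissipation[OF xy] unfolding p_def q_def by blast
  have f: "f (z t) = (r *\<^sub>R (q - x t), r *\<^sub>R (p - y t))"
    by (simp add: vi_field_def r_def p_def q_def x_def y_def split: prod.splits)
  have dx: "(x has_vector_derivative r *\<^sub>R (q - x t)) (at t within {t..})"
    using bounded_linear.has_vector_derivative[OF bounded_linear_fst zt(2)] by (simp add: f x_def)
  have dy: "(y has_vector_derivative r *\<^sub>R (p - y t)) (at t within {t..})"
    using bounded_linear.has_vector_derivative[OF bounded_linear_snd zt(2)] by (simp add: f y_def)
  define \<psi> where "\<psi> = (\<lambda>s. (x s - v) \<bullet> (x s - v) + (x s - y s) \<bullet> (x s - y s))"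
  have "(\<psi> has_real_derivative
      2 * r * ((x t - v) \<bullet> (q - x t) + (x t - y t) \<bullet> ((q - x t) - (p - y t)))) (at t within {t..})"
    unfolding \<psi>_def has_field_derivative_def
    by (rule has_derivative_eq_rhs, (rule derivative_intros
        dx[unfolded has_vector_derivative_def] dy[unfolded has_vector_derivative_def])+)
      (auto simp: fun_eq_iff inner_diff_left inner_diff_right inner_commute algebra_simps)
  moreover have "2 * r * ((x t - v) \<bullet> (q - x t) + (x t - y t) \<bullet> ((q - x t) - (p - y t)))
      \<le> 2 * r * (- d * W (z t))"
    using v(3) rho_nonneg by (intro mult_left_mono) (auto simp: r_def x_def y_def)
  moreover have "\<psi> t = W (z t)"
    using v(2) by (simp add: \<psi>_def W_def x_def y_def flip: v(2) power2_norm_eq_inner)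
  moreover have "W (z s) \<le> \<psi> s" for s
  proof -
    have "infdist (x s) (VI_sol K F) \<le> norm (x s - v)"
      using infdist_le[OF v(1)] by (simp add: dist_norm)
    then have "(infdist (x s) (VI_sol K F))\<^sup>2 \<le> (norm (x s - v))\<^sup>2"
      by (intro power_mono infdist_nonneg)
    then show ?thesis by (simp add: \<psi>_def W_def x_def y_def power2_norm_eq_inner)
  qed
  ultimately show ?thesis
    by (intro exI[of _ \<psi>] exI conjI) (auto simp: r_def x_def y_def algebra_simps)
qed

lemma W_antimono:
  assumes "0 \<le> s" "s \<le> t" shows "W (z t) \<le> W (z s)"
proof -
  have "W (z t) \<le> W (z s) - 0 * (t - s)"
  proof (rule decrease_of_right_majorants[where \<phi> = "\<lambda>t. W (z t)", OF assms(2)])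
    show "continuous_on {s..t} (\<lambda>t. W (z t))"
      using W_continuous assms by (auto intro: continuous_on_subset)
    fix \<tau> assume "s \<le> \<tau>" "\<tau> < t"
    then obtain \<psi> D where "(\<psi> has_real_derivative D) (at \<tau> within {\<tau>..})"
      "D \<le> - (2 * d * rho K F lam \<zeta> (fst (z \<tau>)) (snd (z \<tau>)) * W (z \<tau>))"
      "\<psi> \<tau> = W (z \<tau>)" "\<forall>s. W (z s) \<le> \<psi> s"
      using W_majorant[of \<tau>] assms by auto
    moreover from this(2) have "D \<le> - 0"
      using d_pos rho_nonneg W_nonneg[of "z \<tau>"] by (smt (verit) mult_nonneg_nonneg)
    ultimately show "\<exists>\<psi> D. (\<psi> has_real_derivative D) (at \<tau> within {\<tau>..}) \<and> D \<le> - 0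
        \<and> \<psi> \<tau> = W (z \<tau>) \<and> (\<forall>s\<in>{\<tau>..t}. W (z s) \<le> \<psi> s)"
      by (intro exI[of _ \<psi>] exI[of _ D]) (intro conjI; simp)
  qed
  then show ?thesis by simp
qed

text \<open>The gain bound gives a decay of order \<open>W powr (p + 1)\<close>, and
  \<open>g\<close> is the antiderivative that linearises it. It serves both phases, with
  \<open>p = 1 / 2\<close> and \<open>p = \<zeta> - 1 / 2\<close>.\<close>

lemma W_decrease:
  assumes st: "0 \<le> s" "s \<le> t" and pos: "W (z t) > 0" and k: "k \<ge> 0"
    and deriv: "\<And>w. 0 < w \<Longrightarrow> (g has_real_derivative B * w powr (- p - 1)) (at w)"
    and B: "B \<ge> 0"
    and rho: "\<And>x y. x \<in> K \<Longrightarrow> y \<in> K \<Longrightarrow> W (x, y) > 0 \<Longrightarrow> rho K F lam \<zeta> x y \<ge> k * W (x, y) powr p"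
  shows "g (W (z t)) \<le> g (W (z s)) - 2 * d * B * k * (t - s)"
proof (rule decrease_of_right_majorants_compose[where W = "\<lambda>t. W (z t)", OF st(2) _ _ _ deriv])
  show "continuous_on {s..t} (\<lambda>t. W (z t))"
    using W_continuous st by (auto intro: continuous_on_subset)
  \<comment> \<open>Positivity at the end time propagates backwards because \<open>W\<close> is
    nonincreasing.\<close>
  show pos': "W (z \<tau>) > 0" if "s \<le> \<tau>" "\<tau> \<le> t" for \<tau>
    using W_antimono[of \<tau> t] that st pos by linarith
  show "B * w powr (- p - 1) \<ge> 0" for w using B by simp
  fix \<tau> assume \<tau>: "s \<le> \<tau>" "\<tau> < t"
  let ?r = "rho K F lam \<zeta> (fst (z \<tau>)) (snd (z \<tau>))" and ?w = "W (z \<tau>)"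
  obtain \<psi> D where \<psi>: "(\<psi> has_real_derivative D) (at \<tau> within {\<tau>..})"
    "D \<le> - 2 * d * ?r * ?w" "\<psi> \<tau> = ?w" "\<forall>s. W (z s) \<le> \<psi> s"
    using W_majorant[of \<tau>] \<tau> st by auto
  have w: "?w > 0" using pos'[of \<tau>] \<tau> by simp
  have "z \<tau> \<in> K \<times> K" using z \<tau> st by (auto simp: solution_def)
  then have "k * ?w powr p \<le> ?r" using rho[of "fst (z \<tau>)" "snd (z \<tau>)"] w by (auto simp: mem_Times_iff)
  have "?w powr (- p - 1) * ?w powr p * ?w = 1"
    using w by (simp add: powr_diff powr_minus field_simps)
  then have "2 * d * B * k = B * ?w powr (- p - 1) * (2 * d * (k * ?w powr p) * ?w)"
    by (simp add: mult.assoc mult.left_commute)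
  also have "\<dots> \<le> B * ?w powr (- p - 1) * (2 * d * ?r * ?w)"
    using \<open>k * ?w powr p \<le> ?r\<close> B d_pos w by (intro mult_left_mono mult_right_mono) auto
  also have "\<dots> \<le> B * ?w powr (- p - 1) * (- D)"
    using \<psi>(2) B by (intro mult_left_mono) auto
  finally have "B * ?w powr (- p - 1) * D \<le> - (2 * d * B * k)" by simp
  then show "\<exists>\<psi> D. (\<psi> has_real_derivative D) (at \<tau> within {\<tau>..})
      \<and> B * ?w powr (- p - 1) * D \<le> - (2 * d * B * k) \<and> \<psi> \<tau> = ?w
      \<and> (\<forall>s\<in>{\<tau>..t}. W (z s) \<le> \<psi> s)"
    using \<psi> by (intro exI[of _ \<psi>] exI[of _ D]) auto
qed

end

section \<open>Uniform settling time\<close>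

definition T1_def: "T\<^sub>1 = 1 / (sqrt 2 * d * (1 - c))"
definition T2_def: "T\<^sub>2 = 2 powr (1 / 2 - \<zeta>) * (1 + c) / (d * (1 - c) powr (2 * \<zeta>) * (1 - 2 * \<zeta>))"

lemma time_pos: "T\<^sub>1 > 0" "T\<^sub>2 > 0"
  using d_pos c \<zeta> by (auto simp: T1_def T2_def)

lemma W_T1_le:
  assumes z: "solution f (K \<times> K) z"
  shows "W (z T\<^sub>1) \<le> 2"
proof (cases "W (z T\<^sub>1) > 0")
  case True
  have "- (W (z T\<^sub>1) powr (- 1 / 2))
      \<le> - (W (z 0) powr (- 1 / 2)) - 2 * d * (1 / 2) * (1 - c) * (T\<^sub>1 - 0)"
  proof (rule W_decrease[OF z _ _ True, where p = "1 / 2" and g = "\<lambda>w. - (w powr (- 1 / 2))"])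
    fix w :: real assume "0 < w"
    then show "((\<lambda>w. - (w powr (- 1 / 2))) has_real_derivative 1 / 2 * w powr (- (1 / 2) - 1)) (at w)"
      by (auto intro!: derivative_eq_intros)
  qed (use rho_lower_bounds c time_pos in auto)
  \<comment> \<open>The term from the initial value is nonpositive; dropping it makes the estimate
    uniform in the starting point.\<close>
  also have "\<dots> \<le> - (d * (1 - c) * T\<^sub>1)" by simp
  also have "d * (1 - c) * T\<^sub>1 = 2 powr (- 1 / 2)"
    using d_pos c by (simp add: T1_def powr_minus powr_half_sqrt field_simps)
  finally have *: "2 powr (- 1 / 2) \<le> W (z T\<^sub>1) powr (- 1 / 2)" by simp
  show ?thesis
  proof (rule ccontr)
    assume "\<not> ?thesis"
    then have "W (z T\<^sub>1) powr (- 1 / 2) < 2 powr (- 1 / 2)"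
      by (intro powr_less_mono2_neg) auto
    with * show False by simp
  qed
qed auto

text \<open>Now \<open>g\<close> is a positive power: starting from at most
  \<open>2 powr (1 / 2 - \<zeta>)\<close> it falls at a constant rate and would reach 0 or less by
  the end of the second phase, contradicting positivity.\<close>

lemma W_T2_zero:
  assumes z: "solution f (K \<times> K) z"
  shows "W (z (T\<^sub>1 + T\<^sub>2)) = 0"
proof (rule ccontr)
  let ?p = "1 / 2 - \<zeta>" and ?T = "T\<^sub>1 + T\<^sub>2"
  assume "W (z ?T) \<noteq> 0"
  then have pos: "W (z ?T) > 0" using W_nonneg[of "z ?T"] by simp
  have "W (z ?T) powr ?p
      \<le> W (z T\<^sub>1) powr ?p - 2 * d * ?p * (1 + c) powr (2 * \<zeta> - 1) * (?T - T\<^sub>1)"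
  proof (rule W_decrease[OF z _ _ pos, where p = "\<zeta> - 1 / 2" and g = "\<lambda>w. w powr ?p"])
    fix w :: real assume "0 < w"
    then show "((\<lambda>w. w powr ?p) has_real_derivative ?p * w powr (- (\<zeta> - 1 / 2) - 1)) (at w)"
      by (auto intro!: derivative_eq_intros)
  qed (use rho_lower_bounds \<zeta> time_pos in auto)
  also have "W (z T\<^sub>1) powr ?p \<le> 2 powr ?p"
    using W_T1_le[OF z] W_nonneg \<zeta> by (intro powr_mono2) auto
  \<comment> \<open>Inserting \<open>T\<^sub>2\<close> yields the required amount times the power
    \<open>2 * \<zeta>\<close> of (1 + \<open>c\<close>) / (1 - \<open>c\<close>), a factor at least
    1.\<close>
  also have "2 powr ?p \<le> 2 * d * ?p * (1 + c) powr (2 * \<zeta> - 1) * (?T - T\<^sub>1)"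
  proof -
    have "2 * d * ?p * (1 + c) powr (2 * \<zeta> - 1) * (?T - T\<^sub>1)
        = 2 powr ?p * ((1 + c) powr (2 * \<zeta>) / (1 - c) powr (2 * \<zeta>))"
      using d_pos c \<zeta> by (simp add: T2_def powr_diff divide_simps)
    moreover have "(1 - c) powr (2 * \<zeta>) \<le> (1 + c) powr (2 * \<zeta>)"
      using c \<zeta> by (intro powr_mono2) auto
    then have "1 \<le> (1 + c) powr (2 * \<zeta>) / (1 - c) powr (2 * \<zeta>)" using c by simp
    then have "2 powr ?p * 1 \<le> 2 powr ?p * ((1 + c) powr (2 * \<zeta>) / (1 - c) powr (2 * \<zeta>))"
      by (intro mult_left_mono) auto
    ultimately show ?thesis by simp
  qed
  finally have "W (z ?T) powr ?p \<le> 0" by simp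
  then show False using pos by simp
qed

lemma settles_before:
  assumes z: "solution f (K \<times> K) z" and "z 0 \<notin> M"
  obtains T where "T \<le> T\<^sub>1 + T\<^sub>2" "settles_at M z T"
proof -
  have T: "0 < T\<^sub>1 + T\<^sub>2" using time_pos by simp
  have "z (T\<^sub>1 + T\<^sub>2) \<in> M" using W_T2_zero[OF z] W_zero_iff by blast
  then have zero: "infdist (z (T\<^sub>1 + T\<^sub>2)) M = 0" by (rule infdist_zero)
  \<comment> \<open>The time is positive, hence interior to the half-line, so the two-sided limit in
    \<open>settles_at\<close> is available.\<close>
  have "isCont z (T\<^sub>1 + T\<^sub>2)"
    using continuous_on_interior[OF solution_continuous[OF z]] T by (simp add: interior_real_atLeast)
  then have "isCont (\<lambda>t. infdist (z t) M) (T\<^sub>1 + T\<^sub>2)" by (rule continuous_infdist)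
  then have "settles_at M z (T\<^sub>1 + T\<^sub>2)"
    unfolding settles_at_def isCont_def zero using T by (rule conjI[rotated])
  then show ?thesis using that by blast
qed

section \<open>Stability and the supremum of settling times\<close>

lemma finite_time_stable: "finite_time_stable f (K \<times> K) M"
proof -
  have "positively_invariant f (K \<times> K) M"
    unfolding positively_invariant_def
  proof (intro allI impI)
    fix z t assume z: "solution f (K \<times> K) z \<and> z 0 \<in> M" and t: "(0::real) \<le> t"
    then have "W (z t) \<le> W (z 0)" by (intro W_antimono) auto
    also have "W (z 0) = 0" using z W_zero_iff by blast
    finally have "W (z t) = 0" using W_nonneg[of "z t"] by simp
    then show "z t \<in> M" using W_zero_iff by blast
  qed
  moreover have "stable_set f (K \<times> K) M"
    unfolding stable_set_def
  proof (intro allI impI exI conjI)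
    fix \<epsilon> :: real assume "\<epsilon> > 0"
    \<comment> \<open>With radius \<open>\<epsilon> / 5\<close>, \<open>W\<close> stays at most
      \<open>\<epsilon>\<^sup>2 / 5\<close>, below \<open>(\<epsilon> / 2)\<^sup>2\<close>, which
      matches the factor 2 in \<open>infdist_M_le\<close>.\<close>
    then show "\<epsilon> / 5 > 0" by simp
    fix z t assume z: "solution f (K \<times> K) z \<and> z 0 \<in> nbhd M (\<epsilon> / 5) \<inter> K \<times> K" and t: "(0::real) \<le> t"
    then have "W (z t) \<le> W (z 0)" by (intro W_antimono) auto
    also have "\<dots> \<le> 5 * (\<epsilon> / 5)\<^sup>2" using z W_le_nbhd by blast
    also have "\<dots> < (\<epsilon> / 2)\<^sup>2" using \<open>\<epsilon> > 0\<close> by (simp add: power2_eq_square)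
    finally have "sqrt (W (z t)) < \<epsilon> / 2" using \<open>\<epsilon> > 0\<close> by (intro real_less_lsqrt) auto
    then show "z t \<in> nbhd M \<epsilon>" using infdist_M_le[of "z t"] by (simp add: nbhd_def)
  qed
  moreover have "\<exists>T. settles_at M z T" if "solution f (K \<times> K) z" "z 0 \<notin> M" for z
    using settles_before[OF that] by blast
  ultimately show ?thesis
    using closed_M unfolding finite_time_stable_def by (blast intro: zero_less_one)
qed

lemma settling_time_le:
  assumes "well_posed f (K \<times> K)" "z0 \<in> K \<times> K"
  shows "settling_time f (K \<times> K) M z0 \<le> T\<^sub>1 + T\<^sub>2"
proof (cases "z0 \<in> M")
  case True
  then show ?thesis using time_pos by (simp add: settling_time_def)
next
  case False
  \<comment> \<open>Existence of a trajectory ensures that the infimum is over a nonempty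
    set.\<close>
  obtain z where z: "solution f (K \<times> K) z" "z 0 = z0"
    using assms unfolding well_posed_def by blast
  obtain T where T: "T \<le> T\<^sub>1 + T\<^sub>2" "settles_at M z T"
    using settles_before[OF z(1)] z(2) False by blast
  have "bdd_below {T. \<exists>z. solution f (K \<times> K) z \<and> z 0 = z0 \<and> settles_at M z T}"
    by (rule bdd_belowI[of _ 0]) (auto simp: settles_at_def)
  then have "Inf {T. \<exists>z. solution f (K \<times> K) z \<and> z 0 = z0 \<and> settles_at M z T} \<le> T"
    using z T(2) by (intro cInf_lower) auto
  then show ?thesis using T(1) unfolding settling_time_def if_not_P[OF False] by simp
qed

theorem fixed_time_stable_bound:
  assumes "well_posed f (K \<times> K)"
  shows "fixed_time_stable f (K \<times> K) M"
    and "(SUP z0\<in>K \<times> K. settling_time f (K \<times> K) M z0) \<le> T\<^sub>1 + T\<^sub>2"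
proof -
  have "\<exists>T. settles_at M z T" if "solution f (K \<times> K) z" "z 0 \<notin> M" for z
    using settles_before[OF that] by blast
  then have "globally_finite_time_stable f (K \<times> K) M"
    unfolding globally_finite_time_stable_def using finite_time_stable by blast
  moreover have "bdd_above (settling_time f (K \<times> K) M ` (K \<times> K))"
    using settling_time_le[OF assms] by (auto intro!: bdd_aboveI[of _ "T\<^sub>1 + T\<^sub>2"])
  ultimately show "fixed_time_stable f (K \<times> K) M" by (simp add: fixed_time_stable_def)
  have "K \<noteq> {}" using Sol by (auto simp: VI_sol_def)
  then show "(SUP z0\<in>K \<times> K. settling_time f (K \<times> K) M z0) \<le> T\<^sub>1 + T\<^sub>2"
    using settling_time_le[OF assms] by (intro cSUP_least) auto
qed

end

theorem theorem5:
  fixes K :: "(real ^ 'm) set"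
    and F :: "real ^ 'm \<Rightarrow> real ^ 'm"
    and L \<eta> \<alpha> lam \<zeta> :: real
  assumes "closed K" and "convex K"
    and "L > 0" and "L-lipschitz_on K F"
    and "VI_sol K F \<noteq> {}"
    and "\<eta> > 0"
    and "\<forall>x\<in>K. \<exists>v\<in>nearest_points (closure (VI_sol K F)) x.
           (F x - F v) \<bullet> (x - v) \<ge> \<eta> * (infdist x (VI_sol K F))\<^sup>2"
    and "0 < \<alpha>" and "\<alpha> < min (\<eta> / L\<^sup>2) (1 / (2 * L))"
    and "0 < lam" and "lam < 2 * \<eta> / L\<^sup>2"
    and "0 < \<zeta>" and "\<zeta> < 1 / 2"
    and "well_posed (vi_field K F \<alpha> lam \<zeta>) (K \<times> K)"
  shows "let f = vi_field K F \<alpha> lam \<zeta>;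
             M = {(u, u) | u. u \<in> VI_sol K F};
             d = min (\<alpha> * (\<eta> - \<alpha> * L\<^sup>2)) (1 / 2 - \<alpha> * L);
             c = sqrt (1 - 2 * lam * \<eta> + lam\<^sup>2 * L\<^sup>2)
         in fixed_time_stable f (K \<times> K) M \<and>
            (1 - 2 * lam * \<eta> + lam\<^sup>2 * L\<^sup>2 \<ge> 0 \<longrightarrow>
             (SUP z0\<in>K \<times> K. settling_time f (K \<times> K) M z0)
               \<le> 1 / (sqrt 2 * d * (1 - c))
                 + 2 powr (1 / 2 - \<zeta>) * (1 + c) / (d * (1 - c) powr (2 * \<zeta>) * (1 - 2 * \<zeta>)))"
proof -
  define e where "e = 1 - 2 * lam * \<eta> + lam\<^sup>2 * L\<^sup>2"
  \<comment> \<open>The upper bound on \<open>lam\<close> is what yields \<open>e < 1\<close>, hence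
    a contraction factor below 1.\<close>
  have "lam * L\<^sup>2 < 2 * \<eta>" using assms(3,11) by (simp add: field_simps)
  then have "lam * (lam * L\<^sup>2) < lam * (2 * \<eta>)" using assms(10) by simp
  then have "e < 1" by (simp add: e_def power2_eq_square algebra_simps)
  \<comment> \<open>\<open>e < 0\<close> does occur: if every point of \<open>K\<close> is a solution, then \<open>\<eta>\<close> is unconstrained.\<close>
  interpret extragradient_flow K F L \<eta> \<alpha> lam \<zeta> "sqrt (max 0 e)"
    using assms \<open>e < 1\<close> by unfold_locales (auto simp: e_def)
  \<comment> \<open>For a nonnegative radicand the interpreted factor is the \<open>c\<close> of the
    time bound; fixed-time stability follows for either sign.\<close>
  have "sqrt (max 0 e) = sqrt e" if "e \<ge> 0" using that by simp
  then show ?thesis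
    using fixed_time_stable_bound[OF assms(14)]
    unfolding Let_def e_def[symmetric] d_def[symmetric] T1_def T2_def by auto
qed

end
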